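(* Let $\mathbb F$ be an algebraically closed field of characteristic zero, and let $\mathcal A$ be $\mathbb F[x,x^{-1}]$ or $\mathbb F[x]$. For $a\in\mathbb F$ (with $a\neq 0$ if $\mathcal A=\mathbb F[x,x^{-1}]$) and $n\in\mathbb Z_{\ge 0}$, let $I_{a^n}=((x-a)^n)$ be the ideal of $\mathcal A$ generated by $(x-a)^n$, let $I_{a^n}^{\perp}=\{f\in\mathcal A^*\mid f(I_{a^n})=0\}$, and let $S_a=\bigcup_{n=0}^{\infty}I_{a^n}^{\perp}$. Then $$\mathcal A^{\circ}=\bigoplus_{a\in\mathbb F\setminus\{0\}}S_a\quad\text{if }\mathcal A=\mathbb F[x,x^{-1}],\qquad \mathcal A^{\circ}=\bigoplus_{a\in\mathbb F}S_a\quad\text{if }\mathcal A=\mathbb F[x].$$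
   Context: For an associative unital $\mathbb F$-algebra $\mathcal A$ with multiplication $\mu:\mathcal A\otimes\mathcal A\to\mathcal A$, let $\mathcal A^*$ be the full linear dual, and let $\mu^*:\mathcal A^*\to(\mathcal A\otimes\mathcal A)^*$ be the dual map of $\mu$. Regard $\mathcal A^*\otimes\mathcal A^*$ as a subspace of $(\mathcal A\otimes\mathcal A)^*$ via $(f\otimes g)(a\otimes b)=f(a)g(b)$. A subspace $V\subseteq\mathcal A^*$ is called good if $\mu^*(V)\subseteq V\otimes V$. The space $\mathcal A^\circ$ is the sum of all good subspaces of $\mathcal A^*$; it is the maximal good subspace and is a coalgebra with comultiplication $\mu^*|_{\mathcal A^\circ}$. The sums in the claim are internal direct sums of subspaces (subcoalgebras) of $\mathcal A^\circ$. *)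

theory Defs
  imports
    "HOL-Computational_Algebra.Polynomial"
    "HOL-Library.Poly_Mapping"
    "HOL-Library.Function_Algebras"
begin

section \<open>Spaces of functions and internal direct sums\<close>

definition fun_scale :: "'f::field \<Rightarrow> ('x \<Rightarrow> 'f) \<Rightarrow> 'x \<Rightarrow> 'f"
  where "fun_scale c f = (\<lambda>x. c * f x)"

global_interpretation fun_space: vector_space "fun_scale :: 'f::field \<Rightarrow> ('x \<Rightarrow> 'f) \<Rightarrow> 'x \<Rightarrow> 'f"
  by standard (auto simp: fun_scale_def fun_eq_iff algebra_simps)

definition (in vector_space) internal_direct_sum :: "'b set \<Rightarrow> 'i set \<Rightarrow> ('i \<Rightarrow> 'b set) \<Rightarrow> bool"
  where "internal_direct_sum W I S \<longleftrightarrow>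
    (\<forall>i\<in>I. subspace (S i)) \<and>
    W = span (\<Union>i\<in>I. S i) \<and>
    (\<forall>i\<in>I. S i \<inter> span (\<Union>j\<in>I - {i}. S j) = {0})"


section \<open>The finite dual of an algebra\<close>

locale unital_algebra = vector_space scale
  for scale :: "'f::field \<Rightarrow> 'r::ring_1 \<Rightarrow> 'r" +
  assumes scale_mult_left: "scale c a * b = scale c (a * b)"
    and scale_mult_right: "a * scale c b = scale c (a * b)"
begin

definition dual :: "('r \<Rightarrow> 'f) set"
  where "dual = {f. Vector_Spaces.linear scale (*) f}"

text \<open>
  By the universal property of the tensor product, the linear functionals on
  \<open>A \<otimes> A\<close> are the bilinear forms on \<open>A \<times> A\<close>; a functional \<open>T\<close> is represented by the form
  \<open>(a, b) \<mapsto> T (a \<otimes> b)\<close>.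
\<close>
definition tensor_square_dual :: "('r \<times> 'r \<Rightarrow> 'f) set"
  where "tensor_square_dual = {T.
    (\<forall>a. Vector_Spaces.linear scale (*) (\<lambda>b. T (a, b))) \<and>
    (\<forall>b. Vector_Spaces.linear scale (*) (\<lambda>a. T (a, b)))}"

text \<open>The dual map of the multiplication: \<open>(\<mu>\<^sup>* f) (a \<otimes> b) = f (a b)\<close>.\<close>
definition mult_dual :: "('r \<Rightarrow> 'f) \<Rightarrow> 'r \<times> 'r \<Rightarrow> 'f"
  where "mult_dual f = (\<lambda>(a, b). f (a * b))"

definition tensor :: "('r \<Rightarrow> 'f) \<Rightarrow> ('r \<Rightarrow> 'f) \<Rightarrow> 'r \<times> 'r \<Rightarrow> 'f"
  where "tensor f g = (\<lambda>(a, b). f a * g b)"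

definition tensor_space :: "('r \<Rightarrow> 'f) set \<Rightarrow> ('r \<Rightarrow> 'f) set \<Rightarrow> ('r \<times> 'r \<Rightarrow> 'f) set"
  where "tensor_space V W = fun_space.span {tensor f g |f g. f \<in> V \<and> g \<in> W}"

definition good :: "('r \<Rightarrow> 'f) set \<Rightarrow> bool"
  where "good V \<longleftrightarrow>
    fun_space.subspace V \<and> V \<subseteq> dual \<and> mult_dual ` V \<subseteq> tensor_space V V"

definition finite_dual :: "('r \<Rightarrow> 'f) set"
  where "finite_dual = fun_space.span (\<Union>{V. good V})"

definition subcoalgebra :: "('r \<Rightarrow> 'f) set \<Rightarrow> bool"
  where "subcoalgebra D \<longleftrightarrow>
    fun_space.subspace D \<and> D \<subseteq> finite_dual \<and> mult_dual ` D \<subseteq> tensor_space D D"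

definition annihilator :: "'r set \<Rightarrow> ('r \<Rightarrow> 'f) set"
  where "annihilator I = {f \<in> dual. \<forall>p\<in>I. f p = 0}"

lemma linear_functional_iff:
  "Vector_Spaces.linear scale (*) f \<longleftrightarrow>
    (\<forall>a b. f (a + b) = f a + f b) \<and> (\<forall>c a. f (scale c a) = c * f a)"
proof -
  have "vector_space ((*) :: 'f \<Rightarrow> 'f \<Rightarrow> 'f)"
    by standard (auto simp: algebra_simps)
  then show ?thesis
    using vector_space_axioms by (auto simp: Vector_Spaces.linear_iff)
qed

lemma mult_dual_in_tensor_square_dual:
  "f \<in> dual \<Longrightarrow> mult_dual f \<in> tensor_square_dual"
  by (auto simp: dual_def tensor_square_dual_def mult_dual_def linear_functional_iff
      scale_mult_left scale_mult_right algebra_simps)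

lemma tensor_space_subset_tensor_square_dual:
  assumes "V \<subseteq> dual" "W \<subseteq> dual"
  shows "tensor_space V W \<subseteq> tensor_square_dual"
  unfolding tensor_space_def
proof (rule fun_space.span_minimal)
  show "{tensor f g |f g. f \<in> V \<and> g \<in> W} \<subseteq> tensor_square_dual"
    using assms by (fastforce simp: dual_def tensor_square_dual_def tensor_def
        linear_functional_iff algebra_simps)
  show "fun_space.subspace tensor_square_dual"
    by (auto simp: fun_space.subspace_def tensor_square_dual_def fun_scale_def
        linear_functional_iff algebra_simps)
qed

end


section \<open>The functionals supported at a point\<close>

text \<open>
  The ideals of a commutative ring are the submodules of the ring over itself, so
  \<open>module.span (*)\<close> is the generated ideal.
\<close>
definition ideal_generated :: "'r::comm_ring_1 set \<Rightarrow> 'r set"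
  where "ideal_generated G = module.span (*) G"

text \<open>\<open>S_a = \<Union>\<^sub>n ((x - a)^n)\<^sup>\<bottom>\<close>, where \<open>scale a 1\<close> is the scalar \<open>a\<close> viewed in the algebra.\<close>
definition local_functionals ::
    "('f::field \<Rightarrow> 'r::comm_ring_1 \<Rightarrow> 'r) \<Rightarrow> 'r \<Rightarrow> 'f \<Rightarrow> ('r \<Rightarrow> 'f) set"
  where "local_functionals scale x a =
    (\<Union>n. unital_algebra.annihilator scale (ideal_generated {(x - scale a 1) ^ n}))"


section \<open>Polynomials and Laurent polynomials\<close>

text \<open>
  Laurent polynomials are finitely supported coefficient functions on the integers; the
  multiplication of \<open>poly_mapping\<close> is convolution.
\<close>
type_synonym 'f laurent_poly = "int \<Rightarrow>\<^sub>0 'f"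

definition laurent_scale :: "'f::field \<Rightarrow> 'f laurent_poly \<Rightarrow> 'f laurent_poly"
  where "laurent_scale c p = Poly_Mapping.map ((*) c) p"

definition laurent_X :: "'f::field laurent_poly"
  where "laurent_X = Poly_Mapping.single 1 1"

definition poly_X :: "'f::field poly"
  where "poly_X = [:0, 1:]"

lemma lookup_laurent_scale: "Poly_Mapping.lookup (laurent_scale c p) k = c * Poly_Mapping.lookup p k"
  by (simp add: laurent_scale_def Poly_Mapping.map.rep_eq when_def)

lemma laurent_scale_eq_mult: "laurent_scale c p = Poly_Mapping.single 0 c * p"
  by (rule poly_mapping_eqI)
    (simp add: laurent_scale_def flip: mult_map_scale_conv_mult)

global_interpretation poly_alg: unital_algebra "smult :: 'f::field \<Rightarrow> 'f poly \<Rightarrow> 'f poly"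
  by standard (auto simp: smult_add_right smult_add_left)

global_interpretation laurent_alg:
  unital_algebra "laurent_scale :: 'f::field \<Rightarrow> 'f laurent_poly \<Rightarrow> 'f laurent_poly"
proof
  fix a b :: 'f and p q :: "'f laurent_poly"
  show "laurent_scale a (p + q) = laurent_scale a p + laurent_scale a q"
    "laurent_scale (a + b) p = laurent_scale a p + laurent_scale b p"
    "laurent_scale a (laurent_scale b p) = laurent_scale (a * b) p"
    "laurent_scale 1 p = p"
    by (auto intro!: poly_mapping_eqI simp: lookup_laurent_scale lookup_add algebra_simps)
  show "laurent_scale a p * q = laurent_scale a (p * q)"
    "p * laurent_scale a q = laurent_scale a (p * q)"
    by (simp_all add: laurent_scale_eq_mult mult_ac)
qed

end

theory Submission
  imports Defs
begin

text \<open>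
  If \<open>\<mu>\<^sup>* f\<close> has finite rank, then \<open>f\<close> kills the ideal generated by \<open>p(x)\<close> for some nonzero
  polynomial \<open>p\<close>, because finitely many linear conditions cannot exclude all nonzero polynomials.
  Bezout identities between the powers of distinct linear factors of \<open>p\<close> split \<open>f\<close> into
  functionals killed by powers of \<open>x - a\<close>, and show that such a splitting is unique. Conversely,
  if \<open>(x - a)\<^sup>n\<close> kills \<open>f\<close>, then the translates \<open>v \<mapsto> f (u v)\<close> span a finite-dimensional
  space, and a basis of it with dual points of the algebra expresses \<open>\<mu>\<^sup>* f\<close> as a finite tensor.
  The only facts needed about the two algebras are that \<open>x - a\<close> has the scalars as residues for
  admissible \<open>a\<close>, and is a unit for all other \<open>a\<close>.
\<close>

section \<open>Dual points of finite-dimensional function spaces\<close>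

text \<open>Gaussian elimination with point evaluations as coordinates. The interpolant of the new
  \<open>b\<close> at the points found so far is subtracted; a nonzero remainder supplies one
  further point. Coordinates in the resulting basis \<open>w\<close> are simply the values at
  \<open>P\<close>.\<close>

lemma finite_span_dual_points:
  fixes B :: "('x \<Rightarrow> 'f::field) set"
  assumes "finite B"
  shows "\<exists>P w. finite P \<and> (\<forall>p\<in>P. w p \<in> fun_space.span B) \<and>
    (\<forall>p\<in>P. \<forall>q\<in>P. w p q = (if p = q then 1 else 0)) \<and>
    (\<forall>g\<in>fun_space.span B. g = (\<Sum>p\<in>P. fun_scale (g p) (w p)))"
  using assms
proof (induction B)
  case empty
  show ?case by (intro exI[of _ "{}"]) auto
next
  case (insert b B)
  from insert.IH obtain P w where P: "finite P"
    and wB: "\<forall>p\<in>P. w p \<in> fun_space.span B"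
    and \<delta>: "\<forall>p\<in>P. \<forall>q\<in>P. w p q = (if p = q then 1 else 0)"
    and rep: "\<forall>g\<in>fun_space.span B. g = (\<Sum>p\<in>P. fun_scale (g p) (w p))"
    by (elim exE conjE) (rule that)
  have sum_apply: "(\<Sum>p\<in>Q. F p) z = (\<Sum>p\<in>Q. F p z)" if "finite Q"
    for Q and F :: "'x \<Rightarrow> 'x \<Rightarrow> 'f" and z
    using that by induction auto
  \<comment> \<open>\<open>s\<close> interpolates \<open>b\<close> on \<open>P\<close>, so the
    remainder \<open>b'\<close> vanishes on all of \<open>P\<close>.\<close>
  define s where "s = (\<Sum>p\<in>P. fun_scale (b p) (w p))"
  define b' where "b' = b - s"
  have s: "s \<in> fun_space.span B"
    unfolding s_def by (intro fun_space.span_sum fun_space.span_scale) (use wB in blast)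
  have mono: "fun_space.span B \<subseteq> fun_space.span (insert b B)"
    by (rule fun_space.span_mono) auto
  have b': "b' \<in> fun_space.span (insert b B)"
    unfolding b'_def using s mono by (intro fun_space.span_diff) (auto intro: fun_space.span_base)
  have decomp: "\<exists>t g0. g0 \<in> fun_space.span B \<and> g = g0 + fun_scale t b'"
    if g: "g \<in> fun_space.span (insert b B)" for g
  proof -
    obtain t where t: "g - fun_scale t b \<in> fun_space.span B"
      using g by (auto simp: fun_space.span_breakdown_eq)
    have "(g - fun_scale t b) + fun_scale t s \<in> fun_space.span B"
      using t s by (intro fun_space.span_add fun_space.span_scale)
    moreover have "g = ((g - fun_scale t b) + fun_scale t s) + fun_scale t b'"
      by (auto simp: fun_eq_iff b'_def fun_scale_def algebra_simps)
    ultimately show ?thesis by blast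
  qed
  have b'P: "b' q = 0" if "q \<in> P" for q
  proof -
    have "s q = (\<Sum>p\<in>P. b p * (if p = q then 1 else 0))"
      unfolding s_def sum_apply[OF P]
      by (intro sum.cong) (use \<delta> that in \<open>auto simp: fun_scale_def\<close>)
    also have "\<dots> = b q" using P that by (simp add: if_distrib cong: if_cong)
    finally show ?thesis by (simp add: b'_def)
  qed
  show ?case
  proof (cases "b' = 0")
    case True
    then have "fun_space.span (insert b B) \<subseteq> fun_space.span B"
      using decomp by fastforce
    then show ?thesis
      using P wB \<delta> rep mono by (intro exI[of _ P] exI[of _ w]) blast
  next
    case False
    then obtain v where v: "b' v \<noteq> 0" by (auto simp: fun_eq_iff)
    with b'P have vP: "v \<notin> P" by auto
    \<comment> \<open>\<open>e\<close> is the remainder normalised at the new point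
      \<open>v\<close>. Since \<open>e\<close> vanishes on \<open>P\<close>, subtracting multiples
      of it makes each old \<open>w p\<close> vanish at \<open>v\<close> without changing its values
      on \<open>P\<close>.\<close>
    define e where "e = fun_scale (1 / b' v) b'"
    define w' where "w' p = (if p = v then e else w p - fun_scale (w p v) e)" for p
    have e: "e \<in> fun_space.span (insert b B)"
      unfolding e_def using b' by (rule fun_space.span_scale)
    have ev: "e v = 1" and eP: "\<And>q. q \<in> P \<Longrightarrow> e q = 0"
      using v b'P by (auto simp: e_def fun_scale_def)
    have "w' p \<in> fun_space.span (insert b B)" if "p \<in> insert v P" for p
      using that wB mono e unfolding w'_def
      by (auto intro!: fun_space.span_diff fun_space.span_scale)
    moreover have "w' p q = (if p = q then 1 else 0)" if "p \<in> insert v P" "q \<in> insert v P" for p q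
      using that vP \<delta> ev eP by (auto simp: w'_def fun_scale_def)
    moreover have "g = (\<Sum>p\<in>insert v P. fun_scale (g p) (w' p))"
      if g_span: "g \<in> fun_space.span (insert b B)" for g
    proof -
      obtain t g0 where g0: "g0 \<in> fun_space.span B" and g: "g = g0 + fun_scale t b'"
        using decomp[OF g_span] by blast
      have g0_eq: "g0 z = (\<Sum>p\<in>P. g0 p * w p z)" for z
        using fun_cong[OF bspec[OF rep g0], of z] by (simp add: sum_apply[OF P] fun_scale_def)
      show ?thesis
      proof
        fix z
        have "(\<Sum>p\<in>insert v P. fun_scale (g p) (w' p)) z =
            g v * e z + (\<Sum>p\<in>P. g0 p * (w p z - w p v * e z))"
          using P vP b'P
          by (simp add: sum_apply fun_scale_def w'_def g cong: sum.cong)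
             (intro sum.cong, auto simp: fun_scale_def)
        also have "(\<Sum>p\<in>P. g0 p * (w p z - w p v * e z)) = g0 z - g0 v * e z"
          by (simp add: g0_eq[of z] g0_eq[of v] sum_subtractf sum_distrib_right right_diff_distrib
              mult.assoc)
        also have "g v * e z + (g0 z - g0 v * e z) = g z"
          using v by (simp add: g e_def fun_scale_def algebra_simps)
        finally show "g z = (\<Sum>p\<in>insert v P. fun_scale (g p) (w' p)) z" by simp
      qed
    qed
    ultimately show ?thesis
      using P by (intro exI[of _ "insert v P"] exI[of _ w']) blast
  qed
qed


section \<open>Polynomials\<close>

text \<open>Modulo the linear factor \<open>q\<close> is the nonzero constant
  \<open>poly q a\<close>, which gives the identity for exponent one. Higher exponents follow by
  inserting that identity as a factor 1.\<close>

lemma bezout_linear_power: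
  fixes q :: "'f::field poly"
  assumes "poly q a \<noteq> 0"
  shows "\<exists>u v. u * [:-a, 1:] ^ n + v * q = 1"
proof (induction n)
  case 0
  show ?case by (intro exI[of _ 1] exI[of _ 0]) simp
next
  case (Suc n)
  then obtain u v where n: "u * [:-a, 1:] ^ n + v * q = 1" by blast
  \<comment> \<open>\<open>c\<close> inverts the remainder of \<open>q\<close>, and \<open>r\<close>
    absorbs the quotient.\<close>
  define c where "c = [:1 / poly q a:]"
  define r where "r = - c * synthetic_div q a"
  have "c * ([:-a, 1:] * synthetic_div q a + [:poly q a:]) = c * q"
    by (simp only: synthetic_div_correct')
  then have "r * [:-a, 1:] + c * q = c * [:poly q a:]"
    unfolding r_def by algebra
  also have "\<dots> = 1" using assms by (simp add: c_def one_pCons)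
  finally have one: "r * [:-a, 1:] + c * q = 1" .
  have "(u * r) * [:-a, 1:] ^ Suc n + (u * [:-a, 1:] ^ n * c + v) * q
      = u * [:-a, 1:] ^ n * (r * [:-a, 1:] + c * q) + v * q"
    by (simp only: power_Suc distrib_left distrib_right mult_ac add_ac)
  also have "\<dots> = 1" by (simp only: one n mult_1_right)
  finally show ?case by blast
qed

text \<open>The bound \<open>N\<close> strengthens the induction: it provides two common zeros of
  \<open>G\<close> of different degrees, and a combination of them that kills one more functional
  cannot cancel to zero.\<close>

lemma finite_functionals_common_zero:
  fixes G :: "('f::field poly \<Rightarrow> 'f) set"
  assumes "finite G"
    and "\<And>g p q. g \<in> G \<Longrightarrow> g (p + q) = g p + g q"
    and "\<And>g c p. g \<in> G \<Longrightarrow> g (smult c p) = c * g p"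
  shows "\<exists>p. p \<noteq> 0 \<and> degree p \<ge> N \<and> (\<forall>g\<in>G. g p = 0)"
  using assms
proof (induction G arbitrary: N)
  case empty
  show ?case by (intro exI[of _ "monom 1 N"]) (simp add: degree_monom_eq)
next
  case (insert g G)
  have IH: "\<exists>p. p \<noteq> 0 \<and> degree p \<ge> M \<and> (\<forall>g\<in>G. g p = 0)" for M
    using insert.prems by (intro insert.IH) auto
  obtain p where p: "p \<noteq> 0" "degree p \<ge> N" "\<forall>g\<in>G. g p = 0" using IH by blast
  obtain q where q: "q \<noteq> 0" "degree q \<ge> Suc (degree p)" "\<forall>g\<in>G. g q = 0" using IH by blast
  show ?case
  proof (cases "g p = 0")
    case True
    with p show ?thesis by blast
  next
    case False
    \<comment> \<open>The coefficients make \<open>g r = g p * g q - g q * g p\<close> vanish. The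
      leading term of \<open>q\<close> survives, because \<open>g p\<close> is nonzero and
      \<open>q\<close> has the larger degree.\<close>
    define r where "r = smult (g p) q + smult (- g q) p"
    have "degree r = degree q"
      unfolding r_def using False q
      by (subst degree_add_eq_left) (auto simp: le_less_trans[OF degree_smult_le])
    moreover have "h r = 0" if "h \<in> insert g G" for h
    proof -
      have "h r = g p * h q + (- g q) * h p"
        by (simp only: r_def insert.prems[OF that])
      then show ?thesis using that p(3) q(3) by auto
    qed
    ultimately show ?thesis
      using p q by (intro exI[of _ r]) auto
  qed
qed


section \<open>Algebras with a distinguished element\<close>

lemma ideal_generated_singleton: "ideal_generated {g} = range (\<lambda>b. g * b)"
proof -
  interpret module "(*) :: 'a::comm_ring_1 \<Rightarrow> 'a \<Rightarrow> 'a"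
    by standard (auto simp: algebra_simps)
  show ?thesis
    by (simp add: ideal_generated_def span_singleton mult.commute)
qed

text \<open>\<open>K\<close> is the set of admissible points: all scalars for polynomials, the
  nonzero ones for Laurent polynomials. Both cases share the proof below.\<close>

locale pointed_algebra = unital_algebra scale
  for scale :: "'f::alg_closed_field \<Rightarrow> 'r::comm_ring_1 \<Rightarrow> 'r" +
  fixes x :: 'r and K :: "'f set"
  assumes residue: "a \<in> K \<Longrightarrow> \<exists>c d. b = scale c 1 + (x - scale a 1) * d"
    and unit: "a \<notin> K \<Longrightarrow> \<exists>d. (x - scale a 1) * d = 1"
begin

text \<open>The substitution homomorphism sending the indeterminate to \<open>x\<close>. It carries
  degrees, roots and Bezout identities over to an algebra that may lack a degree.\<close>

definition ev :: "'f poly \<Rightarrow> 'r"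
  where "ev p = poly (map_poly (\<lambda>c. scale c 1) p) x"

lemma ev_0 [simp]: "ev 0 = 0"
  by (simp add: ev_def)

lemma ev_pCons [simp]: "ev (pCons c p) = scale c 1 + x * ev p"
  by (simp add: ev_def map_poly_pCons)

lemma ev_1 [simp]: "ev 1 = 1"
  by (simp add: one_pCons)

lemma ev_add: "ev (p + q) = ev p + ev q"
  by (induction p q rule: poly_induct2) (auto simp: scale_left_distrib algebra_simps)

lemma ev_smult: "ev (smult c p) = scale c (ev p)"
  by (induction p) (auto simp: scale_right_distrib scale_mult_right)

lemma ev_mult: "ev (p * q) = ev p * ev q"
  by (induction p)
    (auto simp: ev_add ev_smult algebra_simps scale_mult_left)

lemma ev_power: "ev (p ^ n) = ev p ^ n"
  by (induction n) (auto simp: ev_mult)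

lemma ev_linear [simp]: "ev [:-a, 1:] = x - scale a 1"
  by simp

section \<open>Functionals, their translates and the spaces \<open>S a\<close>\<close>

lemma dual_iff:
  "f \<in> dual \<longleftrightarrow> (\<forall>a b. f (a + b) = f a + f b) \<and> (\<forall>c a. f (scale c a) = c * f a)"
  by (simp add: dual_def linear_functional_iff)

lemma subspace_dual: "fun_space.subspace dual"
  by (auto simp: fun_space.subspace_def dual_iff fun_scale_def algebra_simps)

lemma translate_dual: "f \<in> dual \<Longrightarrow> (\<lambda>v. f (u * v)) \<in> dual"
  by (simp add: dual_iff distrib_left scale_mult_right)

abbreviation S :: "'f \<Rightarrow> ('r \<Rightarrow> 'f) set"
  where "S \<equiv> local_functionals scale x"

lemma local_functionals_iff:
  "f \<in> S a \<longleftrightarrow> f \<in> dual \<and> (\<exists>n. \<forall>b. f ((x - scale a 1) ^ n * b) = 0)"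
  by (auto simp: local_functionals_def annihilator_def ideal_generated_singleton)

lemma local_functionals_subset_dual: "S a \<subseteq> dual"
  by (auto simp: local_functionals_iff)

lemma translate_local_functionals:
  assumes "f \<in> S a"
  shows "(\<lambda>v. f (u * v)) \<in> S a"
proof -
  obtain n where f: "f \<in> dual" and n: "\<And>b. f ((x - scale a 1) ^ n * b) = 0"
    using assms by (auto simp: local_functionals_iff)
  have "f (u * ((x - scale a 1) ^ n * v)) = 0" for v
    using n[of "u * v"] by (simp add: mult_ac)
  with f show ?thesis by (auto simp: local_functionals_iff translate_dual)
qed

lemma subspace_local_functionals: "fun_space.subspace (S a)"
proof (rule fun_space.subspaceI)
  show "0 \<in> S a"
    using subspace_dual by (simp add: local_functionals_iff fun_space.subspace_0)
  show "fun_scale c f \<in> S a" if "f \<in> S a" for c f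
    using that by (auto simp: local_functionals_iff dual_iff fun_scale_def distrib_left)
  show "f + g \<in> S a" if fg: "f \<in> S a" "g \<in> S a" for f g
  proof -
    let ?y = "x - scale a 1"
    obtain m n where m: "\<And>b. f (?y ^ m * b) = 0" and n: "\<And>b. g (?y ^ n * b) = 0"
      using fg by (auto simp: local_functionals_iff)
    have "f (?y ^ (m + n) * b) = 0" "g (?y ^ (m + n) * b) = 0" for b
      using m[of "?y ^ n * b"] n[of "?y ^ m * b"] by (simp_all add: power_add mult_ac)
    then have "\<forall>b. (f + g) (?y ^ (m + n) * b) = 0" by simp
    with fg subspace_dual show ?thesis
      by (auto simp: local_functionals_iff fun_space.subspace_add)
  qed
qed

section \<open>Comultiplication of the local functionals\<close>

text \<open>Induction on the exponent that kills \<open>f\<close>. Writing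
  \<open>u = c + (x - a) d\<close> splits \<open>f (u * v)\<close> into \<open>c * f v\<close> and a
  translate of \<open>g\<close>, the translate of \<open>f\<close> by \<open>x - a\<close>, which is
  killed by one power less. So each step adds only \<open>f\<close> itself to
  \<open>B\<close>.\<close>

lemma finite_span_translates:
  assumes a: "a \<in> K" and "f \<in> S a"
  shows "\<exists>B. finite B \<and> B \<subseteq> S a \<and> (\<forall>u. (\<lambda>v. f (u * v)) \<in> fun_space.span B)"
proof -
  let ?y = "x - scale a 1"
  have "\<exists>B. finite B \<and> B \<subseteq> S a \<and> (\<forall>u. (\<lambda>v. f (u * v)) \<in> fun_space.span B)"
    if "f \<in> dual" "\<And>b. f (?y ^ n * b) = 0" for f n
    using that
  proof (induction n arbitrary: f)
    case 0
    then have "(\<lambda>v. f (u * v)) = 0" for u by (simp add: fun_eq_iff)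
    then show ?case by (intro exI[of _ "{}"]) simp
  next
    case (Suc n)
    define g where "g = (\<lambda>v. f (?y * v))"
    have "\<exists>B. finite B \<and> B \<subseteq> S a \<and> (\<forall>u. (\<lambda>v. g (u * v)) \<in> fun_space.span B)"
    proof (rule Suc.IH)
      show "g \<in> dual" unfolding g_def using Suc.prems(1) by (rule translate_dual)
      show "g (?y ^ n * b) = 0" for b
        using Suc.prems(2)[of b] by (simp add: g_def mult.assoc)
    qed
    then obtain B where B: "finite B" "B \<subseteq> S a"
      "\<And>u. (\<lambda>v. g (u * v)) \<in> fun_space.span B" by blast
    have "(\<lambda>v. f (u * v)) \<in> fun_space.span (insert f B)" for u
    proof -
      obtain c d where u: "u = scale c 1 + ?y * d" using residue[OF a] by blast
      have "f (u * v) = c * f v + g (d * v)" for v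
      proof -
        have "u * v = scale c v + ?y * (d * v)"
          by (simp add: u distrib_right scale_mult_left mult.assoc)
        with Suc.prems(1) show ?thesis by (simp add: dual_iff g_def)
      qed
      then have "(\<lambda>v. f (u * v)) - fun_scale c f = (\<lambda>v. g (d * v))"
        by (auto simp: fun_eq_iff fun_scale_def)
      with B(3)[of d] have "(\<lambda>v. f (u * v)) - fun_scale c f \<in> fun_space.span B" by simp
      then show ?thesis unfolding fun_space.span_breakdown_eq by (rule exI)
    qed
    moreover have "f \<in> S a" using Suc.prems unfolding local_functionals_iff by blast
    ultimately show ?case using B by (intro exI[of _ "insert f B"]) auto
  qed
  with assms(2) show ?thesis by (auto simp: local_functionals_iff)
qed

text \<open>With dual points \<open>p\<close> for the span of the translates, the function
  \<open>v \<mapsto> f (u * v)\<close> has coordinates \<open>f (u * p)\<close>. As functions of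
  \<open>u\<close> these are again translates of \<open>f\<close>, so both tensor factors stay in
  \<open>S a\<close>.\<close>

lemma good_local_functionals:
  assumes "a \<in> K"
  shows "good (S a)"
  unfolding good_def
proof (intro conjI subspace_local_functionals local_functionals_subset_dual image_subsetI)
  fix f assume f: "f \<in> S a"
  obtain B where B: "finite B" "B \<subseteq> S a" "\<And>u. (\<lambda>v. f (u * v)) \<in> fun_space.span B"
    using finite_span_translates[OF assms f] by blast
  have BS: "fun_space.span B \<subseteq> S a"
    using B(2) subspace_local_functionals by (rule fun_space.span_minimal)
  obtain P w where P: "finite P" and w: "\<And>p. p \<in> P \<Longrightarrow> w p \<in> fun_space.span B"
    and rep: "\<And>g. g \<in> fun_space.span B \<Longrightarrow> g = (\<Sum>p\<in>P. fun_scale (g p) (w p))"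
    using finite_span_dual_points[OF B(1)] by blast
  have sum_apply: "(\<Sum>p\<in>Q. F p) z = (\<Sum>p\<in>Q. F p z)" if "finite Q"
    for Q :: "'r set" and F :: "'r \<Rightarrow> 'y \<Rightarrow> 'f" and z
    using that by induction auto
  have "mult_dual f = (\<Sum>p\<in>P. tensor (\<lambda>u. f (p * u)) (w p))"
  proof
    fix z :: "'r \<times> 'r"
    obtain u v where z: "z = (u, v)" by fastforce
    have "f (u * v) = (\<Sum>p\<in>P. f (u * p) * w p v)"
      using fun_cong[OF rep[OF B(3)[of u]], of v] by (simp add: sum_apply[OF P] fun_scale_def)
    then show "mult_dual f z = (\<Sum>p\<in>P. tensor (\<lambda>u. f (p * u)) (w p)) z"
      by (simp add: z mult_dual_def tensor_def sum_apply[OF P] mult.commute)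
  qed
  also have "\<dots> \<in> tensor_space (S a) (S a)"
    unfolding tensor_space_def
    using translate_local_functionals[OF f] w BS
    by (intro fun_space.span_sum fun_space.span_base) blast
  finally show "mult_dual f \<in> tensor_space (S a) (S a)" .
qed

lemma subcoalgebra_local_functionals:
  assumes "a \<in> K"
  shows "subcoalgebra (S a)"
  using good_local_functionals[OF assms]
  by (auto simp: subcoalgebra_def good_def finite_dual_def intro!: fun_space.span_base)

section \<open>Good functionals are sums of local ones\<close>

text \<open>\<open>T\<close> is a finite sum of pure tensors, and \<open>G\<close> collects their
  left factors.\<close>

lemma tensor_space_finite_left_kernel:
  assumes "T \<in> tensor_space V W" "V \<subseteq> dual"
  shows "\<exists>G. finite G \<and> G \<subseteq> dual \<and> (\<forall>a. (\<forall>g\<in>G. g a = 0) \<longrightarrow> (\<forall>b. T (a, b) = 0))"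
  using assms(1) unfolding tensor_space_def
proof (induction rule: fun_space.span_induct_alt)
  case base
  show ?case by (intro exI[of _ "{}"]) auto
next
  case (step c t T)
  then obtain g h G where g: "g \<in> V" "t = tensor g h"
    and G: "finite G" "G \<subseteq> dual" "\<forall>a. (\<forall>g\<in>G. g a = 0) \<longrightarrow> (\<forall>b. T (a, b) = 0)"
    by blast
  then show ?case
    using assms(2)
    by (intro exI[of _ "insert g G"]) (auto simp: tensor_def fun_scale_def)
qed

text \<open>The left factors of \<open>mult_dual f\<close>, composed with \<open>ev\<close>, are
  finitely many functionals on polynomials and hence have a nonzero common zero.\<close>

lemma good_killed_by_polynomial:
  assumes "good V" "f \<in> V"
  shows "\<exists>p. p \<noteq> 0 \<and> (\<forall>b. f (ev p * b) = 0)"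
proof -
  have "mult_dual f \<in> tensor_space V V" "V \<subseteq> dual" using assms by (auto simp: good_def)
  from tensor_space_finite_left_kernel[OF this] obtain G where G: "finite G" "G \<subseteq> dual"
    "\<And>a b. (\<forall>g\<in>G. g a = 0) \<Longrightarrow> f (a * b) = 0"
    by (auto simp: mult_dual_def)
  have "\<exists>p. p \<noteq> 0 \<and> degree p \<ge> 0 \<and> (\<forall>g\<in>(\<lambda>g. g \<circ> ev) ` G. g p = 0)"
    using G(1,2)
    by (intro finite_functionals_common_zero) (auto simp: ev_add ev_smult dual_iff subset_iff)
  with G(3) show ?thesis by auto
qed

text \<open>Induction on the degree: the full power of one root is split off \<open>p\<close>, and
  the Bezout identity splits \<open>f\<close> accordingly.\<close>

lemma killed_by_polynomial_in_span:
  assumes "f \<in> dual" "p \<noteq> 0" "\<And>b. f (ev p * b) = 0"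
  shows "f \<in> fun_space.span (\<Union>a\<in>K. S a)"
  using assms
proof (induction "degree p" arbitrary: p f rule: less_induct)
  case less
  show ?case
  proof (cases "degree p = 0")
    case True
    then obtain c where c: "p = [:c:]" "c \<noteq> 0"
      using less.prems(2) by (metis degree_eq_zeroE pCons_0_0)
    have "f b = 0" for b
      using less.prems(3)[of "scale (inverse c) b"] c
      by (simp add: scale_mult_left)
    then have "f = 0" by auto
    then show ?thesis by (simp add: fun_space.span_zero)
  next
    case False
    then obtain a where root: "poly p a = 0"
      using alg_closed_imp_poly_has_root[of p] by auto
    \<comment> \<open>Taking the whole multiplicity leaves a cofactor \<open>q\<close> that is
      nonzero at \<open>a\<close>, as the Bezout identity requires.\<close>
    define n where "n = order a p"
    obtain q where p: "p = [:-a, 1:] ^ n * q" and "\<not> [:-a, 1:] dvd q"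
      using order_decomp[OF less.prems(2)] by (auto simp: n_def)
    then have qa: "poly q a \<noteq> 0" by (simp add: poly_eq_0_iff_dvd)
    have q0: "q \<noteq> 0" using p less.prems(2) by auto
    have "n > 0" using root less.prems(2) by (simp add: n_def order_root)
    then have deg: "degree q < degree p"
      using q0 by (simp add: p degree_mult_eq degree_power_eq)
    obtain u v where uv: "u * [:-a, 1:] ^ n + v * q = 1"
      using bezout_linear_power[OF qa] by blast
    define y where "y = x - scale a 1"
    have evp: "ev p = y ^ n * ev q" by (simp add: p ev_mult ev_power y_def del: ev_pCons)
    \<comment> \<open>The factors sum to 1, so \<open>f = f1 + f2\<close>. Each one completes
      \<open>p\<close> crosswise: \<open>f1\<close> is killed by \<open>q\<close>, of smaller
      degree, and \<open>f2\<close> by the power of \<open>x - a\<close>.\<close>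
    define f1 where "f1 = (\<lambda>b. f ((ev u * y ^ n) * b))"
    define f2 where "f2 = (\<lambda>b. f ((ev v * ev q) * b))"
    have "ev u * y ^ n + ev v * ev q = 1"
      using arg_cong[OF uv, of ev] by (simp add: ev_add ev_mult ev_power y_def del: ev_pCons)
    then have "b = (ev u * y ^ n) * b + (ev v * ev q) * b" for b
      by (metis distrib_right mult_1)
    then have f: "f = f1 + f2"
      using less.prems(1) by (metis (no_types, lifting) dual_iff ext f1_def f2_def plus_fun_apply)
    have f1_kill: "f1 (ev q * b) = 0" for b
      using less.prems(3)[of "ev u * b"] by (simp add: f1_def evp mult_ac)
    have f2_kill: "f2 (y ^ n * b) = 0" for b
      using less.prems(3)[of "ev v * b"] by (simp add: f2_def evp mult_ac)
    have "f1 \<in> fun_space.span (\<Union>a\<in>K. S a)"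
      using less.prems(1) f1_kill
      by (intro less.hyps[OF deg _ q0]) (simp_all add: f1_def translate_dual)
    moreover have "f2 \<in> fun_space.span (\<Union>a\<in>K. S a)"
    proof (cases "a \<in> K")
      case True
      have "f2 \<in> S a"
        using f2_kill less.prems(1)
        by (auto simp: local_functionals_iff y_def f2_def translate_dual)
      with True show ?thesis by (auto intro: fun_space.span_base)
    next
      case False
      \<comment> \<open>Outside \<open>K\<close> the element \<open>y\<close> is a unit, so being
        killed by \<open>y ^ n\<close> forces \<open>f2\<close> to be zero.\<close>
      then obtain d where "y * d = 1" using unit by (auto simp: y_def)
      then have "y ^ n * (d ^ n * b) = b" for b
        by (simp flip: mult.assoc power_mult_distrib)
      with f2_kill have "f2 b = 0" for b by metis
      then have "f2 = 0" by auto
      then show ?thesis by (simp add: fun_space.span_zero)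
    qed
    ultimately show ?thesis unfolding f by (rule fun_space.span_add)
  qed
qed

section \<open>Independence of the local summands\<close>

text \<open>Multiplying the killing powers at the points other than \<open>a\<close> gives one
  polynomial that kills the whole sum and has no root at \<open>a\<close>.\<close>

lemma span_local_functionals_killed_away:
  assumes "f \<in> fun_space.span (\<Union>b\<in>J - {a}. S b)"
  shows "f \<in> dual \<and> (\<exists>q. poly q a \<noteq> 0 \<and> (\<forall>b. f (ev q * b) = 0))"
  using assms
proof (induction rule: fun_space.span_induct_alt)
  case base
  show ?case
    by (auto simp: dual_iff intro!: exI[of _ 1])
next
  case (step c g h)
  then obtain a' where a': "a' \<noteq> a" "g \<in> S a'" by blast
  then obtain n where g: "g \<in> dual" and n: "\<And>b. g ((x - scale a' 1) ^ n * b) = 0"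
    by (auto simp: local_functionals_iff)
  obtain q where h: "h \<in> dual" and q: "poly q a \<noteq> 0" "\<And>b. h (ev q * b) = 0"
    using step.IH by blast
  define r where "r = [:-a', 1:] ^ n * q"
  have r: "ev r = (x - scale a' 1) ^ n * ev q"
    by (simp add: r_def ev_mult ev_power del: ev_pCons)
  have "poly r a \<noteq> 0" using a' q(1) by (simp add: r_def)
  moreover have "(fun_scale c g + h) (ev r * b) = 0" for b
    using n[of "ev q * b"] q(2)[of "(x - scale a' 1) ^ n * b"]
    by (simp add: r fun_scale_def mult_ac)
  moreover have "fun_scale c g + h \<in> dual"
    using g h subspace_dual by (simp add: fun_space.subspace_add fun_space.subspace_scale)
  ultimately show ?case by blast
qed

text \<open>A common element is killed both by a power of \<open>x - a\<close> and by some
  \<open>ev q\<close> with \<open>q\<close> nonzero at \<open>a\<close>. By Bezout these generate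
  the unit ideal.\<close>

lemma local_functionals_independent:
  "S a \<inter> fun_space.span (\<Union>b\<in>J - {a}. S b) = {0}"
proof -
  have "f = 0" if f_S: "f \<in> S a" and f_span: "f \<in> fun_space.span (\<Union>b\<in>J - {a}. S b)" for f
  proof -
    obtain n where f: "f \<in> dual" and n: "\<And>b. f ((x - scale a 1) ^ n * b) = 0"
      using f_S by (auto simp: local_functionals_iff)
    obtain q where q: "poly q a \<noteq> 0" "\<And>b. f (ev q * b) = 0"
      using span_local_functionals_killed_away[OF f_span] by blast
    obtain u v where uv: "u * [:-a, 1:] ^ n + v * q = 1"
      using bezout_linear_power[OF q(1)] by blast
    have one: "ev u * (x - scale a 1) ^ n + ev v * ev q = 1"
      using arg_cong[OF uv, of ev] by (simp add: ev_add ev_mult ev_power del: ev_pCons)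
    have "f b = 0" for b
    proof -
      have "b = (x - scale a 1) ^ n * (ev u * b) + ev q * (ev v * b)"
        using one by (metis (no_types, lifting) distrib_right mult.commute mult.left_commute mult_1)
      with f n q(2) show ?thesis by (metis add_0 dual_iff)
    qed
    then show ?thesis by auto
  qed
  moreover have "0 \<in> S a" using subspace_local_functionals by (rule fun_space.subspace_0)
  ultimately show ?thesis by (auto simp: fun_space.span_zero)
qed

theorem finite_dual_direct_sum: "fun_space.internal_direct_sum finite_dual K S"
  unfolding fun_space.internal_direct_sum_def
proof (intro conjI ballI subspace_local_functionals local_functionals_independent subset_antisym)
  show "finite_dual \<subseteq> fun_space.span (\<Union>a\<in>K. S a)"
    unfolding finite_dual_def
  proof (intro fun_space.span_minimal fun_space.subspace_span Union_least subsetI)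
    fix V f assume V: "V \<in> {V. good V}" "f \<in> V"
    then have "f \<in> dual" by (auto simp: good_def)
    with V show "f \<in> fun_space.span (\<Union>a\<in>K. S a)"
      using good_killed_by_polynomial[of V f] killed_by_polynomial_in_span[of f] by blast
  qed
  show "fun_space.span (\<Union>a\<in>K. S a) \<subseteq> finite_dual"
    unfolding finite_dual_def using good_local_functionals
    by (intro fun_space.span_mono) blast
qed

end


section \<open>Polynomials and Laurent polynomials\<close>

lemma pointed_algebra_poly:
  "pointed_algebra (smult :: 'f::alg_closed_field \<Rightarrow> _) poly_X UNIV"
proof
  fix a :: 'f and b :: "'f poly"
  have "poly_X - smult a 1 = [:-a, 1:]" by (simp add: poly_X_def one_pCons)
  then have "b = smult (poly b a) 1 + (poly_X - smult a 1) * synthetic_div b a"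
    using synthetic_div_correct'[of a b] by (simp add: one_pCons add.commute)
  then show "\<exists>c d. b = smult c 1 + (poly_X - smult a 1) * d" by blast
\<comment> \<open>With \<open>K = UNIV\<close> the unit condition is vacuous.\<close>
qed simp

text \<open>The elements congruent to a scalar modulo \<open>y\<close> are closed under sums and
  products. They include the scalars, \<open>X\<close> and, as \<open>a\<close> is invertible, the
  inverse of \<open>X\<close>, hence everything.\<close>

lemma laurent_residue:
  fixes a :: "'f::field"
  assumes "a \<noteq> 0"
  shows "\<exists>c d. b = laurent_scale c 1 + (laurent_X - laurent_scale a 1) * d"
proof -
  define y where "y = laurent_X - laurent_scale a 1"
  define s :: "'f \<Rightarrow> 'f laurent_poly" where "s c = Poly_Mapping.single 0 c" for c
  have scale: "laurent_scale c 1 = s c" for c by (simp add: laurent_scale_eq_mult s_def)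
  have s_add: "s (c + d) = s c + s d" and s_mult: "s (c * d) = s c * s d" for c d
    by (simp_all add: s_def single_add mult_single)
  define R where "R = {b. \<exists>c d. b = s c + y * d}"
  have R_add: "p + q \<in> R" if pq: "p \<in> R" "q \<in> R" for p q
  proof -
    obtain c d c' d' where "p = s c + y * d" "q = s c' + y * d'" using pq unfolding R_def by blast
    then have "p + q = s (c + c') + y * (d + d')" by (simp add: s_add algebra_simps)
    then show ?thesis by (auto simp: R_def)
  qed
  have R_mult: "p * q \<in> R" if pq: "p \<in> R" "q \<in> R" for p q
  proof -
    obtain c d c' d' where "p = s c + y * d" "q = s c' + y * d'" using pq unfolding R_def by blast
    then have "p * q = s (c * c') + y * (d * s c' + s c * d' + y * d * d')"
      by (simp add: s_mult algebra_simps)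
    then show ?thesis by (auto simp: R_def)
  qed
  have R_s: "s c \<in> R" for c
  proof -
    have "s c = s c + y * 0" by simp
    then show ?thesis unfolding R_def by blast
  qed
  have X: "Poly_Mapping.single 1 1 = s a + y"
    by (simp add: y_def scale laurent_X_def)
  then have "Poly_Mapping.single 1 1 = s a + y * 1" by simp
  then have R_X: "Poly_Mapping.single 1 1 \<in> R" unfolding R_def by blast
  define X' :: "'f laurent_poly" where "X' = Poly_Mapping.single (- 1) 1"
  have s_1: "s 1 = 1" by (simp add: s_def)
  have "X' * Poly_Mapping.single 1 1 = 1" by (simp add: X'_def mult_single)
  then have "X' * (s a + y) = 1" by (simp only: X)
  moreover have "s a * s (inverse a) = 1" using assms by (simp add: s_1 flip: s_mult)
  \<comment> \<open>Multiply \<open>X' * (s a + y) = 1\<close> by \<open>s (inverse a)\<close> and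
    solve for the leading \<open>X'\<close>.\<close>
  ultimately have "X' = s (inverse a) + y * (- X' * s (inverse a))" by algebra
  then have R_X': "X' \<in> R" unfolding R_def by blast
  have R_single_1: "Poly_Mapping.single k 1 \<in> R" for k :: int
  proof (induction k rule: int_induct[where k = 0])
    case base
    show ?case using R_s[of 1] by (simp add: s_def)
  next
    case (step1 i)
    then show ?case using R_mult[OF step1(2) R_X] by (simp add: mult_single)
  next
    case (step2 i)
    then show ?case using R_mult[OF step2(2) R_X'] by (simp add: mult_single X'_def)
  qed
  have R_single: "Poly_Mapping.single k c \<in> R" for k c
    using R_mult[OF R_s[of c] R_single_1[of k]] by (simp add: s_def mult_single)
  have "b \<in> R"
  proof (induction b rule: update_induct)
    case const
    show ?case using R_s[of 0] by (simp add: s_def)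
  next
    case (update f k c)
    \<comment> \<open>The induction only updates at an exponent \<open>k\<close> outside the support
      of \<open>f\<close>, so the update is a sum.\<close>
    then have "Poly_Mapping.update k c f = Poly_Mapping.single k c + f"
      by (auto intro!: poly_mapping_eqI
          simp: lookup_update lookup_add lookup_single in_keys_iff when_def)
    with update R_single show ?case by (simp add: R_add)
  qed
  then show ?thesis by (simp add: R_def y_def scale)
qed

lemma pointed_algebra_laurent:
  "pointed_algebra (laurent_scale :: 'f::alg_closed_field \<Rightarrow> _) laurent_X (UNIV - {0})"
proof
  fix a :: 'f and b :: "'f laurent_poly"
  show "\<exists>c d. b = laurent_scale c 1 + (laurent_X - laurent_scale a 1) * d" if "a \<in> UNIV - {0}"
    using laurent_residue[of a b] that by simp
  \<comment> \<open>Only \<open>a = 0\<close> is excluded from \<open>K\<close>, and there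
    \<open>x - a\<close> is \<open>x\<close> itself, with inverse the monomial of exponent
    -1.\<close>
  show "\<exists>d. (laurent_X - laurent_scale a 1) * d = 1" if "a \<notin> UNIV - {0}"
    using that
    by (intro exI[of _ "Poly_Mapping.single (- 1) 1"]) (simp add: laurent_X_def mult_single)
qed

theorem theorem3p5:
  shows "(fun_space.internal_direct_sum
        (laurent_alg.finite_dual :: ('f::{alg_closed_field, field_char_0} laurent_poly \<Rightarrow> 'f) set)
        (UNIV - {0}) (local_functionals laurent_scale laurent_X) \<and>
      (\<forall>a::'f. a \<noteq> 0 \<longrightarrow>
        laurent_alg.subcoalgebra (local_functionals laurent_scale laurent_X a))) \<and>
    (fun_space.internal_direct_sum
        (poly_alg.finite_dual :: ('f poly \<Rightarrow> 'f) set)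
        UNIV (local_functionals smult poly_X) \<and>
      (\<forall>a::'f. poly_alg.subcoalgebra (local_functionals smult poly_X a)))"
  using pointed_algebra.finite_dual_direct_sum[OF pointed_algebra_laurent]
    pointed_algebra.subcoalgebra_local_functionals[OF pointed_algebra_laurent]
    pointed_algebra.finite_dual_direct_sum[OF pointed_algebra_poly]
    pointed_algebra.subcoalgebra_local_functionals[OF pointed_algebra_poly]
  by auto

end
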